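(* Let $\mathcal{H}$ be a complex Hilbert space, $P\in\mathcal{B}(\mathcal{H})$ a nonzero positive operator, $n\ge 1$, $A=[a_{ij}]\in\mathcal{M}_n(\mathbb{C})$ and $B\in\mathcal{B}_{P^{1/2}}(\mathcal{H})$. If $w_P(B)=\|B\|_P$, then $w_{I_n\otimes P}(A\otimes B)=w(A)\|B\|_P$. Conversely, if $a_{ij}\ge 0$ and $a_{ii}\ne 0$ for all $i,j$, and $w_{I_n\otimes P}(A\otimes B)=w(A)\|B\|_P$, then $w_P(B)=\|B\|_P$.
   Context: An operator $P\in\mathcal{B}(\mathcal{H})$ is positive if $\langle Px,x\rangle\ge 0$ for all $x\in\mathcal{H}$. It induces the semi-inner product $\langle x,y\rangle_P=\langle Px,y\rangle$ and seminorm $\|x\|_P=\sqrt{\langle x,x\rangle_P}$ on $\mathcal{H}$. Let $\mathcal{B}_{P^{1/2}}(\mathcal{H})=\{B\in\mathcal{B}(\mathcal{H}) : \exists\lambda>0,\ \|Bx\|_P\le\lambda\|x\|_P\ \forall x\in\mathcal{H}\}$. For $B\in\mathcal{B}_{P^{1/2}}(\mathcal{H})$, the $P$-operator seminorm is $\|B\|_P=\sup\{\|Bx\|_P : x\in\mathcal{H},\ \|x\|_P=1\}$ and the $P$-numerical radius is $w_P(B)=\sup\{|\langle Bx,x\rangle_P| : x\in\mathcal{H},\ \|x\|_P=1\}$. The same notions are used on $\mathcal{H}^n=\mathcal{H}^{\oplus n}$ with the positive operator $I_n\otimes P$ (the block diagonal operator with $n$ copies of $P$) in place of $P$. For $A=[a_{ij}]\in\mathcal{M}_n(\mathbb{C})$,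 $A\otimes B=[a_{ij}B]_{i,j=1}^n$ is the operator matrix acting on $\mathcal{H}^n$; it lies in $\mathcal{B}_{(I_n\otimes P)^{1/2}}(\mathcal{H}^n)$ when $B\in\mathcal{B}_{P^{1/2}}(\mathcal{H})$. For a matrix $A$, $w(A)=\sup\{|\langle Ax,x\rangle| : x\in\mathbb{C}^n,\ \|x\|=1\}$ is the usual numerical radius. *)

theory Defs
  imports "HOL-Analysis.Analysis"
begin

text \<open>
  Complex inner product spaces on top of the library's real normed spaces. The inner product is
  linear in the first and conjugate linear in the second argument, and the given norm, hence also
  the topology, is the induced one.
\<close>

class complex_inner = real_normed_vector +
  fixes scaleC :: "complex \<Rightarrow> 'a \<Rightarrow> 'a" (infixr \<open>*\<^sub>C\<close> 75)
    and cinner :: "'a \<Rightarrow> 'a \<Rightarrow> complex"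
  assumes scaleC_add_right: "a *\<^sub>C (x + y) = a *\<^sub>C x + a *\<^sub>C y"
    and scaleC_add_left: "(a + b) *\<^sub>C x = a *\<^sub>C x + b *\<^sub>C x"
    and scaleC_scaleC: "a *\<^sub>C (b *\<^sub>C x) = (a * b) *\<^sub>C x"
    and scaleR_scaleC: "r *\<^sub>R x = complex_of_real r *\<^sub>C x"
    and cinner_add_left: "cinner (x + y) z = cinner x z + cinner y z"
    and cinner_scaleC_left: "cinner (a *\<^sub>C x) y = a * cinner x y"
    and cinner_commute: "cinner x y = cnj (cinner y x)"
    and norm_eq_sqrt_cinner: "norm x = sqrt (Re (cinner x x))"

class complex_hilbert = complex_inner + complete_space

instantiation complex :: complex_hilbert
begin

definition scaleC_complex :: "complex \<Rightarrow> complex \<Rightarrow> complex"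
  where "scaleC_complex a z = a * z"

definition cinner_complex :: "complex \<Rightarrow> complex \<Rightarrow> complex"
  where "cinner_complex z w = z * cnj w"

instance
  by standard
    (simp_all add: scaleC_complex_def cinner_complex_def algebra_simps scaleR_conv_of_real
       cmod_def power2_eq_square)

end

text \<open>
  The Hilbert direct sum of copies of a space, indexed by a finite type; in particular the
  standard inner product on the library's complex column vectors.
\<close>

instantiation vec :: (complex_inner, finite) complex_inner
begin

definition scaleC_vec :: "complex \<Rightarrow> 'a ^ 'b \<Rightarrow> 'a ^ 'b"
  where "scaleC_vec a x = (\<chi> i. a *\<^sub>C (x $ i))"

definition cinner_vec :: "'a ^ 'b \<Rightarrow> 'a ^ 'b \<Rightarrow> complex"
  where "cinner_vec x y = (\<Sum>i\<in>UNIV. cinner (x $ i) (y $ i))"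

instance
proof
  fix a b :: complex and r :: real and x y z :: "'a ^ 'b"
  show "a *\<^sub>C (x + y) = a *\<^sub>C x + a *\<^sub>C y"
    by (simp add: scaleC_vec_def vec_eq_iff scaleC_add_right)
  show "(a + b) *\<^sub>C x = a *\<^sub>C x + b *\<^sub>C x"
    by (simp add: scaleC_vec_def vec_eq_iff scaleC_add_left)
  show "a *\<^sub>C (b *\<^sub>C x) = (a * b) *\<^sub>C x"
    by (simp add: scaleC_vec_def scaleC_scaleC)
  show "r *\<^sub>R x = complex_of_real r *\<^sub>C x"
    by (simp add: scaleC_vec_def vec_eq_iff scaleR_scaleC)
  show "cinner (x + y) z = cinner x z + cinner y z"
    by (simp add: cinner_vec_def cinner_add_left sum.distrib)
  show "cinner (a *\<^sub>C x) y = a * cinner x y"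
    by (simp add: cinner_vec_def scaleC_vec_def cinner_scaleC_left sum_distrib_left)
  show "cinner x y = cnj (cinner y x)"
    unfolding cinner_vec_def cnj_sum by (rule sum.cong[OF refl]) (rule cinner_commute)
  have "(norm v)\<^sup>2 = Re (cinner v v)" for v :: 'a
    using norm_eq_sqrt_cinner[of v] norm_ge_zero[of v]
    by (metis real_sqrt_ge_0_iff real_sqrt_pow2)
  then show "norm x = sqrt (Re (cinner x x))"
    by (simp add: norm_vec_def L2_set_def cinner_vec_def)
qed

end

instance vec :: (complex_hilbert, finite) complex_hilbert ..

definition bounded_clinear :: "('a::complex_inner \<Rightarrow> 'b::complex_inner) \<Rightarrow> bool"
  where "bounded_clinear T \<longleftrightarrow> bounded_linear T \<and> (\<forall>c x. T (c *\<^sub>C x) = c *\<^sub>C T x)"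

definition positive_op :: "('a::complex_inner \<Rightarrow> 'a) \<Rightarrow> bool"
  where "positive_op P \<longleftrightarrow> bounded_clinear P \<and> (\<forall>x. cinner (P x) x \<in> \<real>\<^sub>\<ge>\<^sub>0)"

definition semi_inner :: "('a::complex_inner \<Rightarrow> 'a) \<Rightarrow> 'a \<Rightarrow> 'a \<Rightarrow> complex"
  where "semi_inner P x y = cinner (P x) y"

definition semi_norm :: "('a::complex_inner \<Rightarrow> 'a) \<Rightarrow> 'a \<Rightarrow> real"
  where "semi_norm P x = sqrt (Re (semi_inner P x x))"

definition semi_bounded_ops :: "('a::complex_inner \<Rightarrow> 'a) \<Rightarrow> ('a \<Rightarrow> 'a) set"
  where "semi_bounded_ops P =
    {B. bounded_clinear B \<and> (\<exists>c>0. \<forall>x. semi_norm P (B x) \<le> c * semi_norm P x)}"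

text \<open>
  The two suprema below are taken in the reals; they are of nonempty sets bounded above whenever
  \<open>P\<close> is positive and nonzero and \<open>B \<in> semi_bounded_ops P\<close>.
\<close>

definition op_seminorm :: "('a::complex_inner \<Rightarrow> 'a) \<Rightarrow> ('a \<Rightarrow> 'a) \<Rightarrow> real"
  where "op_seminorm P B = Sup {semi_norm P (B x) | x. semi_norm P x = 1}"

definition semi_numerical_radius :: "('a::complex_inner \<Rightarrow> 'a) \<Rightarrow> ('a \<Rightarrow> 'a) \<Rightarrow> real"
  where "semi_numerical_radius P B = Sup {cmod (semi_inner P (B x) x) | x. semi_norm P x = 1}"

definition matrix_numerical_radius :: "complex ^ 'n ^ 'n \<Rightarrow> real"
  where "matrix_numerical_radius A = Sup {cmod (cinner (A *v x) x) | x. norm x = 1}"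

definition matrix_tensor_op ::
    "complex ^ 'n ^ 'n \<Rightarrow> ('a::complex_inner \<Rightarrow> 'a) \<Rightarrow> 'a ^ 'n \<Rightarrow> 'a ^ 'n"
  where "matrix_tensor_op A B x = (\<chi> i. \<Sum>j\<in>UNIV. A $ i $ j *\<^sub>C B (x $ j))"

end

theory Submission
  imports Defs
begin

text \<open>
  Write \<open>\<langle>x, y\<rangle>\<close> for the semi-inner product given by \<open>P\<close>, \<open>N\<close> for the seminorm and \<open>w\<close> for the numerical
  radius of \<open>B\<close>. At \<open>x = (x\<^sub>1, \<dots>, x\<^sub>n)\<close> the quadratic form of \<open>A \<otimes> B\<close> is the sum of the numbers
  \<open>a\<^sub>i\<^sub>j \<langle>B x\<^sub>j, x\<^sub>i\<rangle>\<close>.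

  At a product vector \<open>(c\<^sub>1 u, \<dots>, c\<^sub>n u)\<close> it factors as \<open>\<langle>A c, c\<rangle> \<langle>B u, u\<rangle>\<close>, so the numerical radius of
  \<open>A \<otimes> B\<close> is at least \<open>w(A) w\<close> (\<open>tensor_numerical_radius_ge\<close>). Under \<open>w = N\<close> the first half of the
  theorem therefore reduces to the bound \<open>w(A) N\<close> from above (\<open>tensor_pairing_le\<close>).

  That bound holds for every \<open>B\<close>. If \<open>B\<close> were diagonal with entries of modulus \<open>N\<close>, then \<open>A \<otimes> B\<close> would be
  a direct sum of multiples of \<open>A\<close> by such numbers and the bound would be clear. In general,
  \<open>T = B / N\<close> is a contraction for the seminorm, and the forms attached to the Fejer kernel,
  \<open>F\<^sub>\<zeta>(x, y) = \<Sum>\<^bsub>\<bar>k\<bar><M\<^esub> (M - \<bar>k\<bar>) \<zeta>\<^sup>k \<langle>T\<^sup>k x, y\<rangle>\<close>, where a negative power of \<open>T\<close> is read as a positive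
  power acting on \<open>y\<close>, replace the spectral measure of a unitary operator. They are positive
  semidefinite for \<open>\<bar>\<zeta>\<bar> = 1\<close> (\<open>fejer_form_nonneg\<close>). Averaged over suitable roots of unity \<open>\<zeta>\<close>
  they give \<open>M \<langle>x, y\<rangle>\<close>, and with the weight \<open>cnj \<zeta>\<close> they give \<open>(M - 1) \<langle>T x, y\<rangle>\<close>. For each single
  positive semidefinite form \<open>F\<close>, the sum of the \<open>a\<^sub>i\<^sub>j F(x\<^sub>j, x\<^sub>i)\<close> has modulus at most \<open>w(A)\<close>
  times the trace of the Gram matrix, because a Gram matrix is a sum of rank one Gram matrices
  (\<open>gram_pairing_le\<close>). Averaging loses the factor \<open>M / (M - 1)\<close>, which tends to 1.

  For the second half suppose \<open>w < N\<close>. Put \<open>t\<^sub>i\<close> for the seminorm of \<open>x\<^sub>i\<close>; in modulus, the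
  off-diagonal terms are at most \<open>N a\<^sub>i\<^sub>j t\<^sub>j t\<^sub>i\<close> and the diagonal ones even at most \<open>w a\<^sub>i\<^sub>i t\<^sub>i\<^sup>2\<close>. So the
  form at a unit vector is at most \<open>w(A) N - (N - w) min a\<^sub>i\<^sub>i\<close>, which is uniformly below \<open>w(A) N\<close>
  (\<open>tensor_numerical_radius_less\<close>).
\<close>

section \<open>Positive semidefinite forms\<close>

text \<open>
  The form may be degenerate, and it need not be related to the inner product of the space. Both
  freedoms are used: it stands for the semi-inner product of a positive operator as well as for the
  Fejer forms below.
\<close>

locale psd_form =
  fixes s :: "'a::complex_inner \<Rightarrow> 'a \<Rightarrow> complex"
  assumes add_left: "s (x + y) z = s x z + s y z"
    and scale_left: "s (a *\<^sub>C x) y = a * s x y"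
    and commute: "s x y = cnj (s y x)"
    and nonneg: "0 \<le> Re (s x x)"
begin

lemma add_right: "s x (y + z) = s x y + s x z"
  using add_left[of y z x] commute[of x "y + z"] commute[of x y] commute[of x z] by simp

lemma scale_right: "s x (a *\<^sub>C y) = cnj a * s x y"
  using scale_left[of a y x] commute[of x "a *\<^sub>C y"] commute[of x y] by simp

lemma zero_left: "s 0 y = 0"
  using add_left[of 0 0 y] by simp

lemma diff_left: "s (x - y) z = s x z - s y z"
  using add_left[of "x - y" y z] by simp

lemma diff_right: "s x (y - z) = s x y - s x z"
  using add_right[of x "y - z" z] by simp

lemma sum_left: "s (sum f S) y = (\<Sum>k\<in>S. s (f k) y)"
  by (induction S rule: infinite_finite_induct) (simp_all add: zero_left add_left)

lemma self_real: "s x x = complex_of_real (Re (s x x))"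
proof -
  have "Im (s x x) = - Im (s x x)"
    using arg_cong[OF commute[of x x], of Im] by simp
  then show ?thesis
    by (simp add: complex_eq_iff)
qed

text \<open>
  One step of the Gram-Schmidt process: removing the components along \<open>k\<close> takes a form of rank one
  off the given one. It serves both the Cauchy-Schwarz inequality and the splitting of a Gram matrix
  into rank one pieces.
\<close>

lemma residual_form:
  assumes "s k k \<noteq> 0"
  shows "s (u - (s u k / s k k) *\<^sub>C k) (v - (s v k / s k k) *\<^sub>C k) =
    s u v - (s u k / s k k) * cnj (s v k / s k k) * s k k"
proof -
  define \<alpha> \<beta> where "\<alpha> = s u k / s k k" and "\<beta> = s v k / s k k"
  have u: "s u k = \<alpha> * s k k"
    using assms by (simp add: \<alpha>_def)
  have "s v k = \<beta> * s k k"
    using assms by (simp add: \<beta>_def)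
  then have v: "s k v = cnj \<beta> * s k k"
    using commute[of k v] commute[of k k, symmetric] by simp
  show ?thesis
    unfolding \<alpha>_def[symmetric] \<beta>_def[symmetric]
    by (simp add: diff_left diff_right scale_left scale_right u v)
qed

lemma cauchy_schwarz: "(cmod (s x y))\<^sup>2 \<le> Re (s x x) * Re (s y y)"
proof -
  have pivot: "(cmod (s x y))\<^sup>2 \<le> Re (s x x) * Re (s y y)" if "s y y \<noteq> 0" for x y
  proof -
    define q where "q = Re (s y y)"
    have q: "s y y = complex_of_real q"
      using self_real[of y] by (simp add: q_def)
    have "q \<ge> 0"
      by (simp add: q_def nonneg)
    moreover have "q \<noteq> 0"
      using that q by auto
    ultimately have "q > 0" by simp
    have "0 \<le> Re (s x x - (s x y / s y y) * cnj (s x y / s y y) * s y y)"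
      using nonneg[of "x - (s x y / s y y) *\<^sub>C y"] by (simp only: residual_form[OF that])
    also have "(s x y / s y y) * cnj (s x y / s y y) * s y y
        = complex_of_real ((cmod (s x y))\<^sup>2 / q)"
      using \<open>q > 0\<close> complex_norm_square[of "s x y"] by (simp add: q field_simps)
    finally have "(cmod (s x y))\<^sup>2 / q \<le> Re (s x x)"
      by simp
    then show ?thesis
      using \<open>q > 0\<close> by (simp add: q_def[symmetric] field_simps)
  qed
  consider "s y y \<noteq> 0" | "s x x \<noteq> 0" | "s x x = 0" "s y y = 0"
    by blast
  then show ?thesis
  proof cases
    case 1
    then show ?thesis by (rule pivot)
  next
    case 2
    then show ?thesis
      using pivot[of x y] commute[of x y] by (simp add: mult.commute)
  next
    case 3
    \<comment> \<open>Both vectors are null, so the form at \<open>x - s x y *\<^sub>C y\<close> is \<open>- 2 (cmod (s x y))\<^sup>2\<close>.\<close>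
    have "s (x - s x y *\<^sub>C y) (x - s x y *\<^sub>C y) = - 2 * (s x y * cnj (s x y))"
      using 3 commute[of y x] by (simp add: diff_left diff_right scale_left scale_right algebra_simps)
    also have "\<dots> = complex_of_real (- 2 * (cmod (s x y))\<^sup>2)"
      by (simp only: complex_norm_square[symmetric] of_real_mult of_real_minus of_real_numeral)
    finally have "0 \<le> - 2 * (cmod (s x y))\<^sup>2"
      using nonneg[of "x - s x y *\<^sub>C y"] by simp
    then show ?thesis
      using 3 by simp
  qed
qed

lemma cauchy_schwarz_sqrt: "cmod (s x y) \<le> sqrt (Re (s x x)) * sqrt (Re (s y y))"
  using real_sqrt_le_mono[OF cauchy_schwarz[of x y]] by (simp add: real_sqrt_mult)

lemma null_left: "s x x = 0 \<Longrightarrow> s x y = 0"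
  using cauchy_schwarz[of x y] by simp

end


section \<open>The numerical radius of a matrix\<close>

lemma cinner_matrix_vector:
  fixes A :: "complex ^ 'n ^ 'n"
  shows "cinner (A *v x) x = (\<Sum>i\<in>UNIV. \<Sum>j\<in>UNIV. A $ i $ j * (x $ j * cnj (x $ i)))"
  by (simp add: cinner_vec_def cinner_complex_def matrix_vector_mult_def sum_distrib_right
      mult.assoc)

lemma cmod_cinner_matrix_le:
  fixes A :: "complex ^ 'n ^ 'n"
  assumes "norm x = 1"
  shows "cmod (cinner (A *v x) x) \<le> (\<Sum>i\<in>UNIV. \<Sum>j\<in>UNIV. cmod (A $ i $ j))"
proof -
  have "cmod (A $ i $ j * (x $ j * cnj (x $ i))) \<le> cmod (A $ i $ j)" for i j
    using Finite_Cartesian_Product.norm_nth_le[of x i] Finite_Cartesian_Product.norm_nth_le[of x j] assms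
    by (simp add: norm_mult mult_left_le mult_le_one)
  then show ?thesis
    unfolding cinner_matrix_vector by (intro order.trans[OF norm_sum] sum_mono) auto
qed

text \<open>
  The numerical radius is a supremum in the reals, so it dominates the numerical range only because
  the range is bounded; the sum of the moduli of the entries is a crude but sufficient bound.
\<close>

lemma bdd_above_matrix_numerical_range:
  fixes A :: "complex ^ 'n ^ 'n"
  shows "bdd_above {cmod (cinner (A *v x) x) | x. norm x = 1}"
  using cmod_cinner_matrix_le[of _ A] by (auto intro!: bdd_aboveI)

lemma matrix_numerical_radius_upper:
  fixes A :: "complex ^ 'n ^ 'n"
  shows "cmod (cinner (A *v x) x) \<le> matrix_numerical_radius A * (norm x)\<^sup>2"
proof (cases "x = 0")
  case True
  then show ?thesis by (simp add: cinner_vec_def cinner_complex_def)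
next
  case False
  define y where "y = (1 / norm x) *\<^sub>R x"
  have "norm y = 1"
    using False by (simp add: y_def)
  then have "cmod (cinner (A *v y) y) \<le> matrix_numerical_radius A"
    unfolding matrix_numerical_radius_def
    by (intro cSup_upper bdd_above_matrix_numerical_range) auto
  moreover have "cinner (A *v x) x = complex_of_real ((norm x)\<^sup>2) * cinner (A *v y) y"
  proof -
    have "y $ i = x $ i / complex_of_real (norm x)" for i
      unfolding y_def vector_scaleR_component by (simp add: scaleR_conv_of_real)
    then show ?thesis
      using False
      by (simp add: cinner_matrix_vector sum_distrib_left power2_eq_square)
  qed
  ultimately show ?thesis
    by (simp add: norm_mult norm_power mult.commute[of "(norm x)\<^sup>2"] mult_right_mono)
qed

lemma ex_unit_vec: "\<exists>x :: complex ^ 'n. norm x = 1"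
  by (rule exI[of _ "axis undefined 1"]) simp

lemma norm_vec_power2: "(norm (x :: complex ^ 'n))\<^sup>2 = (\<Sum>i\<in>UNIV. (cmod (x $ i))\<^sup>2)"
  by (simp add: norm_vec_def L2_set_def sum_nonneg)

section \<open>Pairing a matrix with a Gram matrix\<close>

text \<open>
  If the vectors are multiples \<open>y\<^sub>i = c\<^sub>i y\<close> of one vector, the left side is \<open>\<bar>\<langle>A c, c\<rangle>\<bar> s(y, y)\<close> and the
  bound is the definition of the numerical radius. In general, each Gram-Schmidt step splits off a
  Gram matrix of this rank one kind and leaves the Gram matrix of the residual vectors; the double
  sum on the left and the trace on the right are additive under the splitting. The number of
  non-null vectors decreases, since the pivot \<open>y k\<close> becomes null and null vectors stay null.
\<close>

lemma (in psd_form) gram_pairing_le: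
  fixes A :: "complex ^ 'n ^ 'n" and y :: "'n \<Rightarrow> 'a"
  shows "cmod (\<Sum>i\<in>UNIV. \<Sum>j\<in>UNIV. A $ i $ j * s (y j) (y i))
    \<le> matrix_numerical_radius A * (\<Sum>i\<in>UNIV. Re (s (y i) (y i)))"
proof (induction "card {i. s (y i) (y i) \<noteq> 0}" arbitrary: y rule: less_induct)
  case less
  show ?case
  proof (cases "\<exists>k. s (y k) (y k) \<noteq> 0")
    case False
    then have "s (y j) (y i) = 0" for i j
      using null_left by blast
    then show ?thesis by simp
  next
    case True
    then obtain k where k: "s (y k) (y k) \<noteq> 0" by blast
    define q where "q = Re (s (y k) (y k))"
    have q: "s (y k) (y k) = complex_of_real q" "q \<ge> 0"
      using self_real[of "y k"] nonneg[of "y k"] by (simp_all add: q_def)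
    \<comment> \<open>coordinates of the vectors along the pivot, and the residual vectors\<close>
    define c :: "complex ^ 'n" where "c = (\<chi> i. s (y i) (y k) / s (y k) (y k))"
    define z where "z = (\<lambda>i. y i - (c $ i) *\<^sub>C y k)"
    have split: "s (y j) (y i) = s (z j) (z i) + q * (c $ j * cnj (c $ i))" for i j
      using residual_form[OF k, of "y j" "y i"] by (simp add: z_def c_def q mult.commute)
    have "s (z k) (z k) = 0"
      using residual_form[OF k, of "y k" "y k"] k q by (simp add: z_def c_def)
    moreover have "s (z i) (z i) = 0" if "s (y i) (y i) = 0" for i
      using that null_left[OF that] residual_form[OF k, of "y i" "y i"] by (simp add: z_def c_def)
    ultimately have "{i. s (z i) (z i) \<noteq> 0} \<subset> {i. s (y i) (y i) \<noteq> 0}"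
      using k by blast
    then have "card {i. s (z i) (z i) \<noteq> 0} < card {i. s (y i) (y i) \<noteq> 0}"
      by (intro psubset_card_mono) auto
    then have IH: "cmod (\<Sum>i\<in>UNIV. \<Sum>j\<in>UNIV. A $ i $ j * s (z j) (z i))
        \<le> matrix_numerical_radius A * (\<Sum>i\<in>UNIV. Re (s (z i) (z i)))"
      by (rule less)
    have "(\<Sum>i\<in>UNIV. \<Sum>j\<in>UNIV. A $ i $ j * s (y j) (y i)) =
        (\<Sum>i\<in>UNIV. \<Sum>j\<in>UNIV. A $ i $ j * s (z j) (z i)) + q * cinner (A *v c) c"
      by (simp add: split cinner_matrix_vector sum_distrib_left distrib_left sum.distrib
          mult.left_commute)
    also have "cmod \<dots> \<le> matrix_numerical_radius A * (\<Sum>i\<in>UNIV. Re (s (z i) (z i)))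
        + q * (matrix_numerical_radius A * (norm c)\<^sup>2)"
      using q(2) by (intro norm_triangle_le add_mono IH)
        (simp add: norm_mult mult_left_mono matrix_numerical_radius_upper)
    also have "\<dots> = matrix_numerical_radius A * (\<Sum>i\<in>UNIV. Re (s (y i) (y i)))"
    proof -
      have "Re (s (y i) (y i)) = Re (s (z i) (z i)) + q * (cmod (c $ i))\<^sup>2" for i
        using split[of i i] complex_norm_square[of "c $ i"]
        by (metis Re_complex_of_real of_real_mult plus_complex.sel(1))
      then show ?thesis
        by (simp add: norm_vec_power2 sum.distrib sum_distrib_left algebra_simps)
    qed
    finally show ?thesis .
  qed
qed

section \<open>Contractions as averages of positive forms\<close>

text \<open>
  A contraction for a degenerate form may lack an adjoint and may be large in the norm of the space, so
  that series of its powers diverge. Therefore the forms below are finite sums, and negative powers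
  are represented by powers acting in the second argument.
\<close>

locale form_contraction = psd_form s
  for s :: "'a::complex_inner \<Rightarrow> 'a \<Rightarrow> complex" +
  fixes T :: "'a \<Rightarrow> 'a"
  assumes T_add: "T (x + y) = T x + T y"
    and T_scale: "T (a *\<^sub>C x) = a *\<^sub>C T x"
    and contraction: "Re (s (T x) (T x)) \<le> Re (s x x)"
begin

definition dirichlet_form :: "complex \<Rightarrow> nat \<Rightarrow> 'a \<Rightarrow> 'a \<Rightarrow> complex"
  where "dirichlet_form \<zeta> m x y = s x y +
    (\<Sum>k\<in>{1..m}. \<zeta> ^ k * s ((T ^^ k) x) y + cnj \<zeta> ^ k * s x ((T ^^ k) y))"

text \<open>
  Summing Dirichlet forms gives the Fejer weights \<open>M - \<bar>k\<bar>\<close>, and makes induction on \<open>M\<close> and averaging over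
  roots of unity immediate.
\<close>

definition fejer_form :: "complex \<Rightarrow> nat \<Rightarrow> 'a \<Rightarrow> 'a \<Rightarrow> complex"
  where "fejer_form \<zeta> M x y = (\<Sum>m<M. dirichlet_form \<zeta> m x y)"

lemma funpow_T_add: "(T ^^ k) (x + y) = (T ^^ k) x + (T ^^ k) y"
  by (induction k) (simp_all add: T_add)

lemma funpow_T_scale: "(T ^^ k) (a *\<^sub>C x) = a *\<^sub>C (T ^^ k) x"
  by (induction k) (simp_all add: T_scale)

text \<open>
  For the partial sums \<open>z m\<close> of \<open>\<Sum>k. (\<zeta> T)\<^sup>k x\<close> one has \<open>z (Suc m) - x = \<zeta> T (z m)\<close>, so contractivity
  bounds \<open>s (z (Suc m) - x) (z (Suc m) - x)\<close> by \<open>s (z m) (z m)\<close>. Expanding the square shows that the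
  Dirichlet form of order \<open>Suc m\<close> at \<open>x\<close>, which is \<open>2 Re (s (z (Suc m)) x) - s x x\<close>, is at least the
  increase of \<open>s (z m) (z m)\<close>. Telescoping, the Fejer form dominates the square of the last partial
  sum.
\<close>

lemma fejer_form_nonneg:
  assumes "cmod \<zeta> = 1"
  shows "0 \<le> Re (fejer_form \<zeta> M x x)"
proof -
  define z where "z m = (\<Sum>k\<le>m. \<zeta> ^ k *\<^sub>C (T ^^ k) x)" for m
  have one: "1 *\<^sub>C x = x" for x :: 'a
    using scaleR_scaleC[of 1 x] by simp
  have step: "z (Suc m) - x = \<zeta> *\<^sub>C T (z m)" for m
  proof (induction m)
    case 0
    then show ?case by (simp add: z_def one)
  next
    case (Suc m)
    have "z (Suc (Suc m)) - x = (z (Suc m) - x) + \<zeta> ^ Suc (Suc m) *\<^sub>C (T ^^ Suc (Suc m)) x"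
      by (simp add: z_def)
    also have "\<dots> = \<zeta> *\<^sub>C T (z m + \<zeta> ^ Suc m *\<^sub>C (T ^^ Suc m) x)"
      unfolding Suc by (simp add: T_add T_scale scaleC_add_right scaleC_scaleC)
    finally show ?case by (simp add: z_def)
  qed
  have dirichlet: "Re (dirichlet_form \<zeta> m x x) = 2 * Re (s (z m) x) - Re (s x x)" for m
  proof -
    have "Re (cnj \<zeta> ^ k * s x ((T ^^ k) x)) = Re (\<zeta> ^ k * s ((T ^^ k) x) x)" for k
    proof -
      have "cnj \<zeta> ^ k * s x ((T ^^ k) x) = cnj (\<zeta> ^ k * s ((T ^^ k) x) x)"
        using commute[of x "(T ^^ k) x"] by simp
      then show ?thesis by (simp only: cnj.sel)
    qed
    then have "Re (dirichlet_form \<zeta> m x x) =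
        Re (s x x) + 2 * (\<Sum>k\<in>{1..m}. Re (\<zeta> ^ k * s ((T ^^ k) x) x))"
      unfolding dirichlet_form_def by (simp add: sum_distrib_left del: times_complex.sel)
    moreover have "Re (s (z m) x) = Re (s x x) + (\<Sum>k\<in>{1..m}. Re (\<zeta> ^ k * s ((T ^^ k) x) x))"
    proof -
      have "{..m} = insert 0 {1..m}" by auto
      then show ?thesis
        by (simp add: z_def add_left sum_left scale_left del: times_complex.sel)
    qed
    ultimately show ?thesis by simp
  qed
  have "Re (s (z m) (z m)) \<le> Re (fejer_form \<zeta> (Suc m) x x)" for m
  proof (induction m)
    case 0
    then show ?case
      by (simp add: z_def fejer_form_def dirichlet_form_def one)
  next
    case (Suc m)
    have "Re (s (z (Suc m) - x) (z (Suc m) - x)) = Re (s (T (z m)) (T (z m)))"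
    proof -
      have "s (\<zeta> *\<^sub>C T (z m)) (\<zeta> *\<^sub>C T (z m)) = (\<zeta> * cnj \<zeta>) * s (T (z m)) (T (z m))"
        by (simp add: scale_left scale_right)
      also have "\<zeta> * cnj \<zeta> = 1"
        using assms complex_norm_square[of \<zeta>] by simp
      finally show ?thesis by (simp add: step)
    qed
    also have "\<dots> \<le> Re (s (z m) (z m))"
      by (rule contraction)
    also have "Re (s (z (Suc m) - x) (z (Suc m) - x)) =
        Re (s (z (Suc m)) (z (Suc m))) - 2 * Re (s (z (Suc m)) x) + Re (s x x)"
      using commute[of x "z (Suc m)"] by (simp add: diff_left diff_right)
    finally show ?case
      using Suc dirichlet[of "Suc m"] by (simp add: fejer_form_def)
  qed
  then show ?thesis
    using nonneg order.trans by (cases M) (simp add: fejer_form_def, blast)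
qed

lemma psd_form_fejer:
  assumes "cmod \<zeta> = 1"
  shows "psd_form (fejer_form \<zeta> M)"
proof
  fix x y z :: 'a and a :: complex
  show "fejer_form \<zeta> M (x + y) z = fejer_form \<zeta> M x z + fejer_form \<zeta> M y z"
    by (simp add: fejer_form_def dirichlet_form_def funpow_T_add add_left sum.distrib
        algebra_simps)
  show "fejer_form \<zeta> M (a *\<^sub>C x) y = a * fejer_form \<zeta> M x y"
    by (simp add: fejer_form_def dirichlet_form_def funpow_T_scale scale_left sum_distrib_left
        distrib_left mult.left_commute)
  have "dirichlet_form \<zeta> m x y = cnj (dirichlet_form \<zeta> m y x)" for m
    by (simp add: dirichlet_form_def commute[symmetric] add.commute)
  then show "fejer_form \<zeta> M x y = cnj (fejer_form \<zeta> M y x)"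
    by (simp add: fejer_form_def)
qed (rule fejer_form_nonneg[OF assms])

end

definition unity_root :: "nat \<Rightarrow> nat \<Rightarrow> complex"
  where "unity_root N l = cis (2 * pi * real l / real N)"

lemma cmod_unity_root: "cmod (unity_root N l) = 1"
  by (simp add: unity_root_def)

lemma sum_unity_root_power:
  assumes "0 < k" "k < N"
  shows "(\<Sum>l<N. unity_root N l ^ k) = 0"
proof -
  define w where "w = cis (2 * pi * real k / real N)"
  have "(\<Sum>l<N. unity_root N l ^ k) = (\<Sum>l<N. w ^ l)"
    unfolding unity_root_def w_def Complex.DeMoivre by (simp add: mult_ac)
  moreover have "w ^ N = 1"
    using assms unfolding w_def Complex.DeMoivre
    by (simp add: cis_multiple_2pi[of "real k", simplified])
  moreover have "w \<noteq> 1"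
  proof
    assume "w = 1"
    then have "exp (\<i> * complex_of_real (2 * pi * real k / real N)) = 1"
      by (simp add: w_def cis_conv_exp)
    then obtain n :: int where "2 * pi * real k / real N = of_int (2 * n) * pi"
      unfolding exp_eq_1 by auto
    then have "real k = of_int n * real N"
      using assms by (simp add: field_simps)
    then have "int k = n * int N"
      by (metis of_int_eq_iff of_int_mult of_int_of_nat_eq)
    then have "int N dvd int k" by simp
    then show False
      using assms by (simp add: nat_dvd_not_less)
  qed
  ultimately show ?thesis
    by (simp add: sum_gp_strict)
qed

lemma sum_cnj_unity_root_power:
  assumes "0 < k" "k < N"
  shows "(\<Sum>l<N. cnj (unity_root N l) ^ k) = 0"
  using arg_cong[OF sum_unity_root_power[OF assms], of cnj] by simp

context form_contraction
begin

text \<open>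
  All frequencies \<open>k\<close> in the form have \<open>\<bar>k\<bar> < N\<close>, so the average over the \<open>N\<close>-th roots of unity retains
  exactly the constant term.
\<close>

lemma sum_dirichlet_form:
  assumes "m < N"
  shows "(\<Sum>l<N. dirichlet_form (unity_root N l) m x y) = of_nat N * s x y"
proof -
  have "(\<Sum>l<N. dirichlet_form (unity_root N l) m x y) = of_nat N * s x y +
    (\<Sum>k\<in>{1..m}. (\<Sum>l<N. unity_root N l ^ k) * s ((T ^^ k) x) y +
       (\<Sum>l<N. cnj (unity_root N l) ^ k) * s x ((T ^^ k) y))"
    unfolding dirichlet_form_def sum.distrib sum_distrib_right
    by (simp add: sum.swap[of _ "{..<N}"])
  also have "\<dots> = of_nat N * s x y"
    using assms by (simp add: sum_unity_root_power sum_cnj_unity_root_power)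
  finally show ?thesis .
qed

text \<open>
  The weight \<open>cnj \<zeta>\<close> shifts the frequencies from \<open>- m, \<dots>, m\<close> to \<open>- m - 1, \<dots>, m - 1\<close>. It moves the term of
  \<open>T\<close>, present for \<open>m \<ge> 1\<close>, to frequency 0; no other frequency is a multiple of \<open>N\<close> when \<open>m + 1 < N\<close>.
\<close>

lemma sum_cnj_dirichlet_form:
  assumes "Suc m < N"
  shows "(\<Sum>l<N. cnj (unity_root N l) * dirichlet_form (unity_root N l) m x y) =
    (if m = 0 then 0 else of_nat N * s (T x) y)"
proof -
  let ?r = "unity_root N"
  have unit: "cnj (?r l) * ?r l = 1" for l
    using complex_norm_square[of "?r l"] by (simp add: cmod_unity_root mult.commute)
  have shift: "cnj (?r l) * ?r l ^ k = ?r l ^ (k - 1)" if "k \<ge> 1" for l k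
    using that unit[of l] by (cases k) (simp_all flip: mult.assoc)
  have "(\<Sum>l<N. cnj (?r l) * dirichlet_form (?r l) m x y) = (\<Sum>l<N. cnj (?r l) ^ 1) * s x y +
    (\<Sum>k\<in>{1..m}. (\<Sum>l<N. cnj (?r l) * ?r l ^ k) * s ((T ^^ k) x) y +
       (\<Sum>l<N. cnj (?r l) ^ Suc k) * s x ((T ^^ k) y))"
    unfolding dirichlet_form_def sum.distrib sum_distrib_right sum_distrib_left distrib_left
    by (simp add: sum.swap[of _ "{..<N}"] mult.assoc)
  also have "\<dots> = (\<Sum>k\<in>{1..m}. (\<Sum>l<N. ?r l ^ (k - 1)) * s ((T ^^ k) x) y)"
  proof -
    have "(\<Sum>l<N. cnj (?r l) ^ Suc k) = 0" if "k \<le> m" for k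
      using that assms by (intro sum_cnj_unity_root_power) auto
    moreover have "(\<Sum>l<N. cnj (?r l) ^ 1) = 0"
      using assms by (intro sum_cnj_unity_root_power) auto
    ultimately show ?thesis
      by (simp add: shift del: power_Suc)
  qed
  also have "\<dots> = (\<Sum>k\<in>{1..m}. if k = 1 then of_nat N * s (T x) y else 0)"
    using assms by (intro sum.cong) (auto simp: sum_unity_root_power)
  also have "\<dots> = (if m = 0 then 0 else of_nat N * s (T x) y)"
    by simp
  finally show ?thesis .
qed

lemma sum_fejer_form:
  assumes "M \<le> N"
  shows "(\<Sum>l<N. fejer_form (unity_root N l) M x y) = of_nat N * of_nat M * s x y"
  using assms unfolding fejer_form_def
  by (subst sum.swap) (simp add: sum_dirichlet_form)

lemma sum_cnj_fejer_form:
  assumes "M < N"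
  shows "(\<Sum>l<N. cnj (unity_root N l) * fejer_form (unity_root N l) M x y) =
    of_nat N * of_nat (M - 1) * s (T x) y"
proof -
  have "(\<Sum>l<N. cnj (unity_root N l) * fejer_form (unity_root N l) M x y) =
    (\<Sum>m<M. if m = 0 then 0 else of_nat N * s (T x) y)"
    unfolding fejer_form_def sum_distrib_left using assms
    by (subst sum.swap) (simp add: sum_cnj_dirichlet_form)
  also have "\<dots> = of_nat N * of_nat (M - 1) * s (T x) y"
    by (cases M) (simp_all add: sum.lessThan_Suc_shift del: sum.lessThan_Suc)
  finally show ?thesis .
qed

text \<open>
  Both the pairing with \<open>T\<close> and the trace on the right are averages over the same Fejer forms, and
  \<open>gram_pairing_le\<close> applies to each of them. The Fejer form with \<open>M + 1\<close> terms has weight \<open>M\<close> on \<open>T\<close>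
  and \<open>M + 1\<close> on the identity, so letting \<open>M\<close> grow gives the constant 1.
\<close>

lemma contraction_pairing_le:
  fixes A :: "complex ^ 'n ^ 'n" and y :: "'n \<Rightarrow> 'a"
  shows "cmod (\<Sum>i\<in>UNIV. \<Sum>j\<in>UNIV. A $ i $ j * s (T (y j)) (y i))
    \<le> matrix_numerical_radius A * (\<Sum>i\<in>UNIV. Re (s (y i) (y i)))"
    (is "cmod ?Q \<le> ?w * ?E")
proof -
  have bound: "real M * cmod ?Q \<le> real (Suc M) * (?w * ?E)" for M
  proof -
    \<comment> \<open>the smallest number of roots above the order \<open>M + 1\<close> of the Fejer form\<close>
    define N where "N = Suc (Suc M)"
    let ?F = "\<lambda>l. fejer_form (unity_root N l) (Suc M)"
    have "of_nat N * of_nat M * ?Q =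
        (\<Sum>i\<in>UNIV. \<Sum>j\<in>UNIV. A $ i $ j * (\<Sum>l<N. cnj (unity_root N l) * ?F l (y j) (y i)))"
      by (subst sum_cnj_fejer_form) (simp_all add: N_def sum_distrib_left mult_ac)
    also have "\<dots> = (\<Sum>l<N. cnj (unity_root N l) *
        (\<Sum>i\<in>UNIV. \<Sum>j\<in>UNIV. A $ i $ j * ?F l (y j) (y i)))"
      by (simp add: sum_distrib_left sum.swap[of _ "{..<N}"] mult.left_commute)
    also have "cmod \<dots> \<le> (\<Sum>l<N. ?w * (\<Sum>i\<in>UNIV. Re (?F l (y i) (y i))))"
      by (intro order.trans[OF norm_sum] sum_mono)
        (simp add: norm_mult cmod_unity_root
          psd_form.gram_pairing_le[OF psd_form_fejer[OF cmod_unity_root]])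
    also have "\<dots> = ?w * (\<Sum>i\<in>UNIV. Re (\<Sum>l<N. ?F l (y i) (y i)))"
      by (simp add: sum_distrib_left sum.swap[of _ "{..<N}"])
    also have "\<dots> = ?w * (real N * real (Suc M) * ?E)"
      by (subst sum_fejer_form) (simp_all add: N_def sum_distrib_left mult_ac del: of_nat_Suc)
    finally have "real N * (real M * cmod ?Q) \<le> real N * (real (Suc M) * (?w * ?E))"
      by (simp add: norm_mult mult_ac del: of_nat_Suc)
    then show ?thesis
      by (simp add: N_def del: of_nat_Suc)
  qed
  show ?thesis
  proof (rule ccontr)
    assume "\<not> ?thesis"
    then have "cmod ?Q - ?w * ?E > 0" by simp
    then obtain M :: nat where "?w * ?E < real M * (cmod ?Q - ?w * ?E)"
      using reals_Archimedean3 by blast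
    with bound[of M] show False
      by (simp add: algebra_simps)
  qed
qed

end

section \<open>The seminorm and numerical radius of an operator\<close>

text \<open>
  Real values of \<open>\<langle>P u, u\<rangle>\<close> force hermitian symmetry by polarization: at \<open>x + y\<close> they settle the
  imaginary parts, and at \<open>x + \<i> y\<close> the real parts.
\<close>

lemma psd_form_semi_inner:
  fixes P :: "'h::complex_inner \<Rightarrow> 'h"
  assumes "positive_op P"
  shows "psd_form (semi_inner P)"
proof
  have lin: "P (u + v) = P u + P v" "P (a *\<^sub>C u) = a *\<^sub>C P u" for u v a
    using assms by (auto simp: positive_op_def bounded_clinear_def linear_simps)
  have pos: "cinner (P u) u \<in> \<real>\<^sub>\<ge>\<^sub>0" for u
    using assms by (simp add: positive_op_def)
  have add_right: "cinner u (v + w) = cinner u v + cinner u w" for u v w :: 'h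
    using cinner_add_left[of v w u] cinner_commute[of u] by simp
  have scale_right: "cinner u (a *\<^sub>C v) = cnj a * cinner u v" for u v :: 'h and a
    using cinner_scaleC_left[of a v u] cinner_commute[of u] by simp
  fix x y z :: 'h and a :: complex
  show "semi_inner P (x + y) z = semi_inner P x z + semi_inner P y z"
    "semi_inner P (a *\<^sub>C x) y = a * semi_inner P x y"
    by (simp_all add: semi_inner_def lin cinner_add_left cinner_scaleC_left)
  show "0 \<le> Re (semi_inner P x x)"
    using pos[of x] by (simp add: semi_inner_def complex_nonneg_Reals_iff)
  have real: "Im (cinner (P u) u) = 0" for u
    using pos[of u] by (simp add: complex_nonneg_Reals_iff)
  let ?p = "cinner (P x) y" and ?q = "cinner (P y) x"
  have "Im (?p + ?q) = 0"
    using real[of "x + y"] real[of x] real[of y] by (simp add: lin cinner_add_left add_right)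
  moreover have "Im (\<i> * ?q - \<i> * ?p) = 0"
    using real[of "x + \<i> *\<^sub>C y"] real[of x] real[of y]
    by (simp add: lin cinner_add_left add_right cinner_scaleC_left scale_right)
  ultimately show "semi_inner P x y = cnj (semi_inner P y x)"
    by (simp add: semi_inner_def complex_eq_iff)
qed

lemma semi_inner_amplification:
  "semi_inner (matrix_tensor_op (mat 1 :: complex ^ 'n ^ 'n) P) x y =
    (\<Sum>i\<in>UNIV. semi_inner P (x $ i) (y $ i))"
proof -
  have scale: "1 *\<^sub>C v = v" "0 *\<^sub>C v = 0" for v :: 'a
    using scaleR_scaleC[of 1 v] scaleR_scaleC[of 0 v] by simp_all
  have "(mat 1 :: complex ^ 'n ^ 'n) $ i $ j *\<^sub>C v = (if j = i then v else 0)" for i j and v :: 'a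
    by (simp add: mat_def scale)
  then show ?thesis
    by (simp add: semi_inner_def matrix_tensor_op_def cinner_vec_def)
qed

locale semi_hilbert_op =
  fixes P B :: "'h::complex_inner \<Rightarrow> 'h"
  assumes positive: "positive_op P"
    and nonzero: "P \<noteq> (\<lambda>x. 0)"
    and semi_bounded: "B \<in> semi_bounded_ops P"
begin

sublocale form: psd_form "semi_inner P"
  by (rule psd_form_semi_inner[OF positive])

lemma semi_norm_power2: "(semi_norm P x)\<^sup>2 = Re (semi_inner P x x)"
  by (simp add: semi_norm_def form.nonneg)

lemma semi_norm_nonneg: "0 \<le> semi_norm P x"
  by (simp add: semi_norm_def form.nonneg)

lemma semi_norm_scale: "semi_norm P (a *\<^sub>C x) = cmod a * semi_norm P x"
proof -
  have "semi_inner P (a *\<^sub>C x) (a *\<^sub>C x) = complex_of_real ((cmod a)\<^sup>2) * semi_inner P x x"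
    unfolding complex_norm_square by (simp add: form.scale_left form.scale_right)
  then show ?thesis
    by (simp add: semi_norm_def real_sqrt_mult)
qed

lemma cmod_semi_inner_le: "cmod (semi_inner P x y) \<le> semi_norm P x * semi_norm P y"
  using form.cauchy_schwarz_sqrt[of x y] by (simp add: semi_norm_def)

lemma B_add: "B (x + y) = B x + B y"
  and B_scale: "B (a *\<^sub>C x) = a *\<^sub>C B x"
  using semi_bounded by (auto simp: semi_bounded_ops_def bounded_clinear_def linear_simps)

lemma ex_normalized:
  assumes "semi_norm P x \<noteq> 0"
  obtains u where "x = complex_of_real (semi_norm P x) *\<^sub>C u" "semi_norm P u = 1"
proof
  let ?r = "complex_of_real (semi_norm P x)"
  show "x = ?r *\<^sub>C (1 / ?r) *\<^sub>C x"
    using assms scaleR_scaleC[of 1 x] by (simp add: scaleC_scaleC)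
  show "semi_norm P ((1 / ?r) *\<^sub>C x) = 1"
    using assms semi_norm_nonneg[of x] by (simp add: semi_norm_scale norm_divide)
qed

text \<open>
  If \<open>P x \<noteq> 0\<close>, then \<open>x\<close> pairs nontrivially with \<open>P x\<close>, and by the Cauchy-Schwarz inequality \<open>x\<close> is not a
  null vector. This makes the suprema that define the seminorm and the numerical radius run over
  nonempty sets.
\<close>

lemma ex_semi_unit: "\<exists>u. semi_norm P u = 1"
proof -
  obtain x where x: "P x \<noteq> 0"
    using nonzero by blast
  have "semi_inner P x (P x) \<noteq> 0"
    using x norm_eq_sqrt_cinner[of "P x"] by (auto simp: semi_inner_def)
  then have "semi_norm P x \<noteq> 0"
    using cmod_semi_inner_le[of x "P x"] by auto
  then show ?thesis
    using ex_normalized by metis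
qed

text \<open>
  Null vectors cannot be normalized; for them the claim comes from the qualitative bound that defines
  \<open>semi_bounded_ops\<close>, which makes \<open>B x\<close> null too.
\<close>

lemma semi_norm_le: "semi_norm P (B x) \<le> op_seminorm P B * semi_norm P x"
proof -
  obtain c where c: "\<And>x. semi_norm P (B x) \<le> c * semi_norm P x"
    using semi_bounded by (auto simp: semi_bounded_ops_def)
  have unit: "semi_norm P (B u) \<le> op_seminorm P B" if "semi_norm P u = 1" for u
    unfolding op_seminorm_def
  proof (rule cSup_upper)
    show "bdd_above {semi_norm P (B x) |x. semi_norm P x = 1}"
      by (rule bdd_aboveI[of _ c]) (clarify, metis c mult.right_neutral)
  qed (use that in blast)
  show ?thesis
  proof (cases "semi_norm P x = 0")
    case True
    then show ?thesis
      using c[of x] by simp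
  next
    case False
    then obtain u where u: "x = complex_of_real (semi_norm P x) *\<^sub>C u" "semi_norm P u = 1"
      by (rule ex_normalized)
    have "semi_norm P (B x) = semi_norm P x * semi_norm P (B u)"
      using u(1) semi_norm_nonneg[of x] by (metis B_scale semi_norm_scale norm_of_real abs_of_nonneg)
    then show ?thesis
      using mult_right_mono[OF unit[OF u(2)] semi_norm_nonneg[of x]] by (simp add: mult.commute)
  qed
qed

lemma op_seminorm_nonneg: "0 \<le> op_seminorm P B"
proof -
  obtain u where "semi_norm P u = 1"
    using ex_semi_unit by blast
  then show ?thesis
    using semi_norm_le[of u] semi_norm_nonneg[of "B u"] by simp
qed

lemma cmod_semi_inner_op_le:
  "cmod (semi_inner P (B x) y) \<le> op_seminorm P B * (semi_norm P x * semi_norm P y)"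
  using order.trans[OF cmod_semi_inner_le[of "B x" y]
      mult_right_mono[OF semi_norm_le[of x] semi_norm_nonneg[of y]]]
  by (simp add: mult.assoc)

lemma semi_numerical_range_le:
  "semi_norm P x = 1 \<Longrightarrow> cmod (semi_inner P (B x) x) \<le> op_seminorm P B"
  using cmod_semi_inner_op_le[of x x] by simp

lemma bdd_above_semi_numerical_range:
  "bdd_above {cmod (semi_inner P (B x) x) | x. semi_norm P x = 1}"
  by (rule bdd_aboveI[of _ "op_seminorm P B"]) (use semi_numerical_range_le in blast)

lemma semi_numerical_radius_upper:
  "cmod (semi_inner P (B x) x) \<le> semi_numerical_radius P B * (semi_norm P x)\<^sup>2"
proof (cases "semi_norm P x = 0")
  case True
  then show ?thesis
    using cmod_semi_inner_op_le[of x x] by simp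
next
  case False
  then obtain u where u: "x = complex_of_real (semi_norm P x) *\<^sub>C u" "semi_norm P u = 1"
    by (rule ex_normalized)
  have "cmod (semi_inner P (B u) u) \<le> semi_numerical_radius P B"
    unfolding semi_numerical_radius_def using u(2)
    by (intro cSup_upper bdd_above_semi_numerical_range) blast
  moreover have "semi_inner P (B x) x = complex_of_real ((semi_norm P x)\<^sup>2) * semi_inner P (B u) u"
    by (subst (1 2) u(1))
      (simp add: B_scale form.scale_left form.scale_right power2_eq_square)
  ultimately show ?thesis
    by (simp add: norm_mult norm_power mult.commute mult_right_mono)
qed

lemma semi_numerical_radius_le: "semi_numerical_radius P B \<le> op_seminorm P B"
  unfolding semi_numerical_radius_def
proof (rule cSup_least)
  show "{cmod (semi_inner P (B x) x) |x. semi_norm P x = 1} \<noteq> {}"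
    using ex_semi_unit by blast
qed (use semi_numerical_range_le in blast)

section \<open>The tensor product\<close>

lemma semi_inner_tensor:
  "semi_inner (matrix_tensor_op (mat 1) P) (matrix_tensor_op A B x) x =
    (\<Sum>i\<in>UNIV. \<Sum>j\<in>UNIV. A $ i $ j * semi_inner P (B (x $ j)) (x $ i))"
  for A :: "complex ^ 'n ^ 'n"
  unfolding semi_inner_amplification
  by (simp add: matrix_tensor_op_def form.sum_left form.scale_left)

lemma semi_norm_amplification:
  "semi_norm (matrix_tensor_op (mat 1 :: complex ^ 'n ^ 'n) P) x = 1 \<longleftrightarrow>
    (\<Sum>i\<in>UNIV. (semi_norm P (x $ i))\<^sup>2) = 1"
  by (simp add: semi_norm_def[of "matrix_tensor_op (mat 1) P"] semi_inner_amplification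
      semi_norm_power2)

lemma ex_tensor_unit:
  fixes c :: "complex ^ 'n"
  assumes "norm c = 1" "semi_norm P u = 1"
  shows "semi_norm (matrix_tensor_op (mat 1 :: complex ^ 'n ^ 'n) P) (\<chi> i. c $ i *\<^sub>C u) = 1"
  using assms norm_vec_power2[of c] by (simp add: semi_norm_amplification semi_norm_scale)

text \<open>
  Division by the operator seminorm turns \<open>B\<close> into a contraction for the form. If the seminorm is 0, all
  entries \<open>\<langle>B y\<^sub>j, y\<^sub>i\<rangle>\<close> vanish by the Cauchy-Schwarz inequality.
\<close>

lemma tensor_pairing_le:
  fixes A :: "complex ^ 'n ^ 'n" and y :: "'n \<Rightarrow> 'h"
  shows "cmod (\<Sum>i\<in>UNIV. \<Sum>j\<in>UNIV. A $ i $ j * semi_inner P (B (y j)) (y i))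
    \<le> matrix_numerical_radius A * op_seminorm P B * (\<Sum>i\<in>UNIV. (semi_norm P (y i))\<^sup>2)"
proof (cases "op_seminorm P B = 0")
  case True
  then have "semi_inner P (B (y j)) (y i) = 0" for i j
    using cmod_semi_inner_op_le[of "y j" "y i"] by simp
  then show ?thesis
    using True by simp
next
  case False
  define N where "N = op_seminorm P B"
  have N: "N > 0"
    using False op_seminorm_nonneg by (simp add: N_def)
  define T where "T x = complex_of_real (1 / N) *\<^sub>C B x" for x
  interpret form_contraction "semi_inner P" T
  proof
    fix x y :: 'h and a :: complex
    show "T (x + y) = T x + T y" "T (a *\<^sub>C x) = a *\<^sub>C T x"
      by (simp_all add: T_def B_add B_scale scaleC_add_right scaleC_scaleC mult.commute)
    have "semi_norm P (T x) \<le> semi_norm P x"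
      using semi_norm_le[of x] N by (simp add: T_def semi_norm_scale N_def norm_divide field_simps)
    then show "Re (semi_inner P (T x) (T x)) \<le> Re (semi_inner P x x)"
      using power_mono[OF _ semi_norm_nonneg[of "T x"], of "semi_norm P x" 2]
      by (simp add: semi_norm_power2)
  qed
  have "semi_inner P (B x) z = complex_of_real N * semi_inner P (T x) z" for x z
    using N by (simp add: T_def form.scale_left)
  then have "(\<Sum>i\<in>UNIV. \<Sum>j\<in>UNIV. A $ i $ j * semi_inner P (B (y j)) (y i)) =
      complex_of_real N * (\<Sum>i\<in>UNIV. \<Sum>j\<in>UNIV. A $ i $ j * semi_inner P (T (y j)) (y i))"
    by (simp add: sum_distrib_left mult.left_commute)
  then show ?thesis
    using contraction_pairing_le[of A y] N
    by (simp add: norm_mult semi_norm_power2 N_def[symmetric] mult.commute mult.left_commute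
        mult_left_mono)
qed

lemma tensor_numerical_range_le:
  fixes A :: "complex ^ 'n ^ 'n"
  assumes "semi_norm (matrix_tensor_op (mat 1 :: complex ^ 'n ^ 'n) P) x = 1"
  shows "cmod (semi_inner (matrix_tensor_op (mat 1) P) (matrix_tensor_op A B x) x)
    \<le> matrix_numerical_radius A * op_seminorm P B"
  using tensor_pairing_le[of A "\<lambda>i. x $ i"] assms
  by (simp add: semi_inner_tensor semi_norm_amplification)

lemma ex_amplification_unit:
  "\<exists>x. semi_norm (matrix_tensor_op (mat 1 :: complex ^ 'n ^ 'n) P) x = 1"
  using ex_unit_vec ex_semi_unit ex_tensor_unit by blast

lemma tensor_numerical_radius_le:
  fixes A :: "complex ^ 'n ^ 'n"
  assumes "\<And>x. (\<Sum>i\<in>UNIV. (semi_norm P (x $ i))\<^sup>2) = 1 \<Longrightarrow>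
    cmod (\<Sum>i\<in>UNIV. \<Sum>j\<in>UNIV. A $ i $ j * semi_inner P (B (x $ j)) (x $ i)) \<le> b"
  shows "semi_numerical_radius (matrix_tensor_op (mat 1) P) (matrix_tensor_op A B) \<le> b"
  unfolding semi_numerical_radius_def
proof (rule cSup_least)
  show "{cmod (semi_inner (matrix_tensor_op (mat 1) P) (matrix_tensor_op A B x) x) |x.
      semi_norm (matrix_tensor_op (mat 1) P) x = 1} \<noteq> {}"
    using ex_amplification_unit by blast
qed (use assms in \<open>auto simp: semi_norm_amplification semi_inner_tensor\<close>)

text \<open>
  Product vectors give the product of any two elements of the numerical ranges. The two suprema are
  then taken one after the other; a factor 0 is treated apart because each step divides by the
  other factor.
\<close>

lemma tensor_numerical_radius_ge:
  fixes A :: "complex ^ 'n ^ 'n"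
  shows "matrix_numerical_radius A * semi_numerical_radius P B
    \<le> semi_numerical_radius (matrix_tensor_op (mat 1) P) (matrix_tensor_op A B)"
    (is "_ \<le> ?R")
proof -
  have product: "cmod (cinner (A *v c) c) * cmod (semi_inner P (B u) u) \<le> ?R"
    if "norm c = 1" "semi_norm P u = 1" for c u
  proof -
    let ?x = "\<chi> i. c $ i *\<^sub>C u"
    have "semi_inner (matrix_tensor_op (mat 1) P) (matrix_tensor_op A B ?x) ?x =
        cinner (A *v c) c * semi_inner P (B u) u"
      by (simp add: semi_inner_tensor cinner_matrix_vector B_scale form.scale_left
          form.scale_right sum_distrib_left sum_distrib_right mult_ac)
    moreover have "cmod (semi_inner (matrix_tensor_op (mat 1) P) (matrix_tensor_op A B ?x) ?x) \<le> ?R"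
      unfolding semi_numerical_radius_def
      using tensor_numerical_range_le[of _ A] ex_tensor_unit[OF that]
      by (intro cSup_upper bdd_aboveI[of _ "matrix_numerical_radius A * op_seminorm P B"]) auto
    ultimately show ?thesis
      by (simp add: norm_mult)
  qed
  have radius_B: "cmod (cinner (A *v c) c) * semi_numerical_radius P B \<le> ?R" if "norm c = 1" for c
  proof (cases "cmod (cinner (A *v c) c) = 0")
    case True
    then show ?thesis
      using product[OF that] ex_semi_unit by auto
  next
    case False
    then have pos: "cmod (cinner (A *v c) c) > 0" by simp
    have "semi_numerical_radius P B \<le> ?R / cmod (cinner (A *v c) c)"
      unfolding semi_numerical_radius_def[of P B]
    proof (rule cSup_least)
      show "{cmod (semi_inner P (B x) x) |x. semi_norm P x = 1} \<noteq> {}"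
        using ex_semi_unit by blast
    qed (use product[OF that] pos in \<open>auto simp: field_simps\<close>)
    then show ?thesis
      using pos by (simp add: field_simps)
  qed
  show ?thesis
  proof (cases "semi_numerical_radius P B = 0")
    case True
    then show ?thesis
      using radius_B ex_unit_vec by auto
  next
    case False
    obtain u where "semi_norm P u = 1"
      using ex_semi_unit by blast
    then have pos: "semi_numerical_radius P B > 0"
      using False order.trans[OF norm_ge_zero semi_numerical_radius_upper[of u]] by simp
    have "matrix_numerical_radius A \<le> ?R / semi_numerical_radius P B"
      unfolding matrix_numerical_radius_def
    proof (rule cSup_least)
      show "{cmod (cinner (A *v x) x) |x. norm x = 1} \<noteq> {}"
        using ex_unit_vec by blast
    qed (use radius_B pos in \<open>auto simp: field_simps\<close>)
    then show ?thesis
      using pos by (simp add: field_simps)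
  qed
qed

text \<open>
  The vector of seminorms \<open>t\<close> is a unit vector, and since the entries of \<open>A\<close> are nonnegative,
  replacing every \<open>\<langle>B x\<^sub>j, x\<^sub>i\<rangle>\<close> by \<open>N t\<^sub>j t\<^sub>i\<close> leads to a value of the quadratic form of \<open>A\<close>. On the diagonal
  the smaller \<open>w t\<^sub>i\<^sup>2\<close> is available. The smallest diagonal entry \<open>\<delta>\<close> makes this gain uniform in the
  vector, so that it survives the supremum.
\<close>

lemma tensor_numerical_radius_less:
  fixes A :: "complex ^ 'n ^ 'n"
  assumes entries: "\<And>i j. A $ i $ j \<in> \<real>\<^sub>\<ge>\<^sub>0"
    and diagonal: "\<And>i. A $ i $ i \<noteq> 0"
    and less: "semi_numerical_radius P B < op_seminorm P B"
  shows "semi_numerical_radius (matrix_tensor_op (mat 1) P) (matrix_tensor_op A B)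
    < matrix_numerical_radius A * op_seminorm P B"
proof -
  define a where "a i j = Re (A $ i $ j)" for i j
  have A: "A $ i $ j = complex_of_real (a i j)" and a_nonneg: "0 \<le> a i j" for i j
    using entries[of i j] by (simp_all add: a_def complex_nonneg_Reals_iff complex_eq_iff)
  define w where "w = semi_numerical_radius P B"
  define N where "N = op_seminorm P B"
  define \<delta> where "\<delta> = Min (range (\<lambda>i. a i i))"
  have "\<delta> \<in> range (\<lambda>i. a i i)"
    unfolding \<delta>_def by (rule Min_in) auto
  then obtain k where "\<delta> = a k k" by blast
  then have "\<delta> > 0"
    using a_nonneg[of k k] diagonal[of k] by (simp add: A)
  have \<delta>: "\<delta> \<le> a i i" for i
    by (simp add: \<delta>_def)
  have "semi_numerical_radius (matrix_tensor_op (mat 1) P) (matrix_tensor_op A B)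
      \<le> matrix_numerical_radius A * N - (N - w) * \<delta>"
  proof (rule tensor_numerical_radius_le)
    fix x :: "'h ^ 'n"
    assume unit: "(\<Sum>i\<in>UNIV. (semi_norm P (x $ i))\<^sup>2) = 1"
    define t where "t i = semi_norm P (x $ i)" for i
    have entry: "cmod (A $ i $ j * semi_inner P (B (x $ j)) (x $ i))
        \<le> N * (a i j * (t j * t i)) - (if j = i then (N - w) * (a i i * (t i)\<^sup>2) else 0)" for i j
    proof (cases "j = i")
      case True
      then show ?thesis
        using mult_left_mono[OF semi_numerical_radius_upper[of "x $ i"] a_nonneg[of i i]]
          a_nonneg[of i i]
        by (simp add: A norm_mult w_def t_def algebra_simps power2_eq_square)
    next
      case False
      then show ?thesis
        using mult_left_mono[OF cmod_semi_inner_op_le[of "x $ j" "x $ i"] a_nonneg[of i j]]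
          a_nonneg[of i j]
        by (simp add: A norm_mult N_def t_def algebra_simps)
    qed
    have "cmod (\<Sum>i\<in>UNIV. \<Sum>j\<in>UNIV. A $ i $ j * semi_inner P (B (x $ j)) (x $ i))
        \<le> (\<Sum>i\<in>UNIV. \<Sum>j\<in>UNIV. N * (a i j * (t j * t i)) -
            (if j = i then (N - w) * (a i i * (t i)\<^sup>2) else 0))"
      by (intro order.trans[OF norm_sum] sum_mono entry)
    also have "\<dots> = N * (\<Sum>i\<in>UNIV. \<Sum>j\<in>UNIV. a i j * (t j * t i)) -
        (N - w) * (\<Sum>i\<in>UNIV. a i i * (t i)\<^sup>2)"
      by (simp add: sum_subtractf sum_distrib_left)
    also have "\<dots> \<le> N * matrix_numerical_radius A - (N - w) * \<delta>"
    proof (intro diff_mono mult_left_mono)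
      define c :: "complex ^ 'n" where "c = (\<chi> i. complex_of_real (t i))"
      have "(norm c)\<^sup>2 = 1"
        using unit by (simp add: norm_vec_power2 c_def t_def)
      moreover have "cinner (A *v c) c = complex_of_real (\<Sum>i\<in>UNIV. \<Sum>j\<in>UNIV. a i j * (t j * t i))"
        by (simp add: cinner_matrix_vector c_def A)
      ultimately show "(\<Sum>i\<in>UNIV. \<Sum>j\<in>UNIV. a i j * (t j * t i)) \<le> matrix_numerical_radius A"
        using matrix_numerical_radius_upper[of A c]
        by (simp only: norm_of_real mult_1_right abs_le_iff)
      have "\<delta> = (\<Sum>i\<in>UNIV. \<delta> * (t i)\<^sup>2)"
        using unit by (simp add: t_def flip: sum_distrib_left)
      also have "\<dots> \<le> (\<Sum>i\<in>UNIV. a i i * (t i)\<^sup>2)"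
        by (intro sum_mono mult_right_mono \<delta>) simp
      finally show "\<delta> \<le> (\<Sum>i\<in>UNIV. a i i * (t i)\<^sup>2)" .
    qed (use less op_seminorm_nonneg in \<open>simp_all add: w_def N_def\<close>)
    finally show "cmod (\<Sum>i\<in>UNIV. \<Sum>j\<in>UNIV. A $ i $ j * semi_inner P (B (x $ j)) (x $ i))
        \<le> matrix_numerical_radius A * N - (N - w) * \<delta>"
      by (simp add: mult.commute)
  qed
  also have "\<dots> < matrix_numerical_radius A * N"
    using less \<open>\<delta> > 0\<close> by (simp add: w_def N_def)
  finally show ?thesis
    by (simp add: N_def)
qed

end

section \<open>The equality case\<close>

theorem proposition3p9:
  fixes P B :: "'h::complex_hilbert \<Rightarrow> 'h"
    and A :: "complex ^ 'n ^ 'n"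
  assumes "positive_op P"
    and "P \<noteq> (\<lambda>x. 0)"
    and "B \<in> semi_bounded_ops P"
  shows "(semi_numerical_radius P B = op_seminorm P B \<longrightarrow>
            semi_numerical_radius (matrix_tensor_op (mat 1) P) (matrix_tensor_op A B)
              = matrix_numerical_radius A * op_seminorm P B)
       \<and> ((\<forall>i j. A $ i $ j \<in> \<real>\<^sub>\<ge>\<^sub>0) \<and> (\<forall>i. A $ i $ i \<noteq> 0) \<and>
            semi_numerical_radius (matrix_tensor_op (mat 1) P) (matrix_tensor_op A B)
              = matrix_numerical_radius A * op_seminorm P B \<longrightarrow>
            semi_numerical_radius P B = op_seminorm P B)"
proof -
  interpret semi_hilbert_op P B
    using assms by unfold_locales
  have "semi_numerical_radius (matrix_tensor_op (mat 1) P) (matrix_tensor_op A B)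
      \<le> matrix_numerical_radius A * op_seminorm P B"
  proof (rule tensor_numerical_radius_le)
    fix x :: "'h ^ 'n"
    assume "(\<Sum>i\<in>UNIV. (semi_norm P (x $ i))\<^sup>2) = 1"
    then show "cmod (\<Sum>i\<in>UNIV. \<Sum>j\<in>UNIV. A $ i $ j * semi_inner P (B (x $ j)) (x $ i))
        \<le> matrix_numerical_radius A * op_seminorm P B"
      using tensor_pairing_le[of A "\<lambda>i. x $ i"] by simp
  qed
  then show ?thesis
    using tensor_numerical_radius_ge[of A] tensor_numerical_radius_less[of A]
      semi_numerical_radius_le
    by (auto simp: order.order_iff_strict)
qed

end
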